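(* Let $(\mathfrak{g},\langle\cdot,\cdot\rangle)$ be a non-abelian $4$-dimensional metric Lie algebra, and let $H:\mathfrak{g}\to\mathfrak{g}$ be a parallel skew-symmetric endomorphism which is not a multiple of a complex structure. Then there exists an orthogonal basis $\{e_1,f_1,e_2,f_2\}$ of $\mathfrak{g}$ such that there are $a_1,a_2\in\mathbb{R}$ with $|a_1|\neq|a_2|$ and $$He_1=a_1f_1,\quad Hf_1=-a_1e_1,\quad He_2=a_2f_2,\quad Hf_2=-a_2e_2,$$ and such that the Lie brackets and the inner product are given by one of the following (brackets of basis elements not listed and not determined by antisymmetry are zero; $\mathrm{diag}$ denotes the Gram matrix of $\langle\cdot,\cdot\rangle$ in the ordered basis $(e_1,f_1,e_2,f_2)$): (1) $\mathbb{R}\times\mathfrak{e}(2)$: $[e_1,e_2]=-f_2$, $[e_1,f_2]=e_2$, with inner product $\mathrm{diag}(t,t,t,t)$, $t>0$; (2) $\mathbb{R}^2\times\mathfrak{aff}(\mathbb{R})$: $[e_2,f_2]=f_2$, with inner product $\mathrm{diag}(t,t,t,t)$, $t>0$; (3) $\mathfrak{r}'_{4,\lambda,0}$, $\lambda>0$: $[e_1,f_1]=\lambda f_1$, $[e_1,f_2]=e_2$, $[e_1,e_2]=-f_2$, with inner product $\mathrm{diag}(t,t,t,t)$, $t>0$; (4) $\mathfrak{aff}(\mathbb{R})\times\mathfrak{aff}(\mathbb{R})$: $[e_1,f_1]=f_1$, $[e_2,f_2]=f_2$, with inner product $\mathrm{diag}(t,t,ts,ts)$, $t>0$, $0<s\le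 1$. Moreover, for each of the metric Lie algebras in (1)-(4) and all $a_1,a_2\in\mathbb{R}$, the endomorphism defined by $e_i\mapsto a_if_i$, $f_i\mapsto -a_ie_i$ ($i=1,2$) is parallel.
   Context: A metric Lie algebra $(\mathfrak{g},\langle\cdot,\cdot\rangle)$ is a finite-dimensional real Lie algebra $\mathfrak{g}$ with a (positive definite) inner product. For $x\in\mathfrak{g}$, the endomorphism $\nabla_x:\mathfrak{g}\to\mathfrak{g}$ is defined by the Koszul formula $2\langle\nabla_xy,z\rangle=\langle[x,y],z\rangle-\langle[y,z],x\rangle+\langle[z,x],y\rangle$ for all $y,z\in\mathfrak{g}$. A linear endomorphism $H:\mathfrak{g}\to\mathfrak{g}$ that is skew-symmetric with respect to $\langle\cdot,\cdot\rangle$ is called parallel if $\nabla_x(Hy)=H\nabla_xy$ for all $x,y\in\mathfrak{g}$. A skew-symmetric endomorphism $H$ is "not a multiple of a complex structure" if $H^2\neq-\lambda^2 I$ for every $\lambda\in\mathbb{R}$ (in particular $H\ne0$). *)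

theory Defs
  imports "HOL-Analysis.Analysis"
begin

text \<open>The metric of a metric Lie algebra is the inner product of the type class
  \<^class>\<open>euclidean_space\<close>; only the bracket is an explicit parameter.\<close>

locale metric_lie_algebra =
  fixes br :: "'a::euclidean_space \<Rightarrow> 'a \<Rightarrow> 'a"
  assumes bilinear_br: "bilinear br"
    and alternating: "br x x = 0"
    and jacobi: "br x (br y z) + br y (br z x) + br z (br x y) = 0"

definition abelian :: "('a::euclidean_space \<Rightarrow> 'a \<Rightarrow> 'a) \<Rightarrow> bool" where
  "abelian br \<longleftrightarrow> (\<forall>x y. br x y = 0)"

definition nabla :: "('a::euclidean_space \<Rightarrow> 'a \<Rightarrow> 'a) \<Rightarrow> 'a \<Rightarrow> 'a \<Rightarrow> 'a" where
  "nabla br x y = (THE w. \<forall>z. 2 * (w \<bullet> z) = br x y \<bullet> z - br y z \<bullet> x + br z x \<bullet> y)"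

lemma koszul:
  fixes br :: "'a::euclidean_space \<Rightarrow> 'a \<Rightarrow> 'a"
  assumes "bilinear br"
  shows "2 * (nabla br x y \<bullet> z) = br x y \<bullet> z - br y z \<bullet> x + br z x \<bullet> y"
proof -
  define k where "k z = (br x y \<bullet> z - br y z \<bullet> x + br z x \<bullet> y) / 2" for z
  have lin: "linear k"
    unfolding k_def
    by (rule linearI)
      (simp_all add: bilinear_radd[OF assms] bilinear_ladd[OF assms] bilinear_rmul[OF assms]
        bilinear_lmul[OF assms] inner_add_left inner_add_right algebra_simps add_divide_distrib
        diff_divide_distrib)
  define w where "w = (\<Sum>b\<in>Basis. k b *\<^sub>R b)"
  have w: "w \<bullet> z = k z" for z
  proof -
    have "k z = k (\<Sum>b\<in>Basis. (z \<bullet> b) *\<^sub>R b)"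
      by (simp add: euclidean_representation)
    also have "\<dots> = (\<Sum>b\<in>Basis. (z \<bullet> b) * k b)"
      by (simp add: linear_sum[OF lin] linear_scale[OF lin])
    also have "\<dots> = w \<bullet> z"
      by (simp add: w_def inner_sum_left inner_commute[of z] mult.commute)
    finally show ?thesis by simp
  qed
  have "\<forall>z. 2 * (nabla br x y \<bullet> z) = br x y \<bullet> z - br y z \<bullet> x + br z x \<bullet> y"
    unfolding nabla_def
  proof (rule theI)
    show "\<forall>z. 2 * (w \<bullet> z) = br x y \<bullet> z - br y z \<bullet> x + br z x \<bullet> y"
      by (simp add: w k_def)
  next
    fix v assume v: "\<forall>z. 2 * (v \<bullet> z) = br x y \<bullet> z - br y z \<bullet> x + br z x \<bullet> y"
    have "v \<bullet> z = w \<bullet> z" for z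
      using w[of z] v[rule_format, of z] by (simp add: k_def)
    then show "v = w"
      by (metis vector_eq_rdot)
  qed
  then show ?thesis by blast
qed

definition skew_symmetric :: "('a::euclidean_space \<Rightarrow> 'a) \<Rightarrow> bool" where
  "skew_symmetric H \<longleftrightarrow> linear H \<and> (\<forall>x y. H x \<bullet> y = - (x \<bullet> H y))"

definition parallel_skew ::
    "('a::euclidean_space \<Rightarrow> 'a \<Rightarrow> 'a) \<Rightarrow> ('a \<Rightarrow> 'a) \<Rightarrow> bool" where
  "parallel_skew br H \<longleftrightarrow>
     skew_symmetric H \<and> (\<forall>x y. nabla br x (H y) = H (nabla br x y))"

text \<open>The value \<open>c = 0\<close> is allowed, so that \<open>H = 0\<close> counts as a multiple.\<close>

definition multiple_of_complex_structure :: "('a::euclidean_space \<Rightarrow> 'a) \<Rightarrow> bool" where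
  "multiple_of_complex_structure H \<longleftrightarrow>
     (\<exists>c::real. \<forall>x. H (H x) = - (c\<^sup>2) *\<^sub>R x)"

definition basis4 :: "'a::euclidean_space \<Rightarrow> 'a \<Rightarrow> 'a \<Rightarrow> 'a \<Rightarrow> bool" where
  "basis4 u1 u2 u3 u4 \<longleftrightarrow>
     distinct [u1, u2, u3, u4] \<and> independent {u1, u2, u3, u4} \<and> span {u1, u2, u3, u4} = UNIV"

definition orthogonal_basis4 :: "'a::euclidean_space \<Rightarrow> 'a \<Rightarrow> 'a \<Rightarrow> 'a \<Rightarrow> bool" where
  "orthogonal_basis4 u1 u2 u3 u4 \<longleftrightarrow>
     basis4 u1 u2 u3 u4 \<and> pairwise orthogonal {u1, u2, u3, u4}"

definition gram_diag ::
    "'a::euclidean_space \<Rightarrow> 'a \<Rightarrow> 'a \<Rightarrow> 'a \<Rightarrow> real \<Rightarrow> real \<Rightarrow> real \<Rightarrow> real \<Rightarrow> bool" where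
  "gram_diag u1 u2 u3 u4 d1 d2 d3 d4 \<longleftrightarrow>
     u1 \<bullet> u1 = d1 \<and> u2 \<bullet> u2 = d2 \<and> u3 \<bullet> u3 = d3 \<and> u4 \<bullet> u4 = d4 \<and>
     u1 \<bullet> u2 = 0 \<and> u1 \<bullet> u3 = 0 \<and> u1 \<bullet> u4 = 0 \<and>
     u2 \<bullet> u3 = 0 \<and> u2 \<bullet> u4 = 0 \<and> u3 \<bullet> u4 = 0"

definition block_rotation ::
    "('a::euclidean_space \<Rightarrow> 'a) \<Rightarrow> 'a \<Rightarrow> 'a \<Rightarrow> 'a \<Rightarrow> 'a \<Rightarrow> real \<Rightarrow> real \<Rightarrow> bool" where
  "block_rotation H e1 f1 e2 f2 a1 a2 \<longleftrightarrow>
     H e1 = a1 *\<^sub>R f1 \<and> H f1 = - a1 *\<^sub>R e1 \<and> H e2 = a2 *\<^sub>R f2 \<and> H f2 = - a2 *\<^sub>R e2"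

definition metric_R_e2 ::
    "('a::euclidean_space \<Rightarrow> 'a \<Rightarrow> 'a) \<Rightarrow> 'a \<Rightarrow> 'a \<Rightarrow> 'a \<Rightarrow> 'a \<Rightarrow> bool" where
  "metric_R_e2 br e1 f1 e2 f2 \<longleftrightarrow>
     br e1 f1 = 0 \<and> br e1 e2 = - f2 \<and> br e1 f2 = e2 \<and>
     br f1 e2 = 0 \<and> br f1 f2 = 0 \<and> br e2 f2 = 0 \<and>
     (\<exists>t>0. gram_diag e1 f1 e2 f2 t t t t)"

definition metric_R2_aff ::
    "('a::euclidean_space \<Rightarrow> 'a \<Rightarrow> 'a) \<Rightarrow> 'a \<Rightarrow> 'a \<Rightarrow> 'a \<Rightarrow> 'a \<Rightarrow> bool" where
  "metric_R2_aff br e1 f1 e2 f2 \<longleftrightarrow>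
     br e1 f1 = 0 \<and> br e1 e2 = 0 \<and> br e1 f2 = 0 \<and>
     br f1 e2 = 0 \<and> br f1 f2 = 0 \<and> br e2 f2 = f2 \<and>
     (\<exists>t>0. gram_diag e1 f1 e2 f2 t t t t)"

definition metric_r4_prime ::
    "('a::euclidean_space \<Rightarrow> 'a \<Rightarrow> 'a) \<Rightarrow> 'a \<Rightarrow> 'a \<Rightarrow> 'a \<Rightarrow> 'a \<Rightarrow> real \<Rightarrow> bool" where
  "metric_r4_prime br e1 f1 e2 f2 l \<longleftrightarrow>
     br e1 f1 = l *\<^sub>R f1 \<and> br e1 e2 = - f2 \<and> br e1 f2 = e2 \<and>
     br f1 e2 = 0 \<and> br f1 f2 = 0 \<and> br e2 f2 = 0 \<and>
     (\<exists>t>0. gram_diag e1 f1 e2 f2 t t t t)"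

definition metric_aff_aff ::
    "('a::euclidean_space \<Rightarrow> 'a \<Rightarrow> 'a) \<Rightarrow> 'a \<Rightarrow> 'a \<Rightarrow> 'a \<Rightarrow> 'a \<Rightarrow> bool" where
  "metric_aff_aff br e1 f1 e2 f2 \<longleftrightarrow>
     br e1 f1 = f1 \<and> br e1 e2 = 0 \<and> br e1 f2 = 0 \<and>
     br f1 e2 = 0 \<and> br f1 f2 = 0 \<and> br e2 f2 = f2 \<and>
     (\<exists>t s. t > 0 \<and> 0 < s \<and> s \<le> 1 \<and> gram_diag e1 f1 e2 f2 t t (t * s) (t * s))"

definition listed_metric_lie_algebra ::
    "('a::euclidean_space \<Rightarrow> 'a \<Rightarrow> 'a) \<Rightarrow> 'a \<Rightarrow> 'a \<Rightarrow> 'a \<Rightarrow> 'a \<Rightarrow> bool" where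
  "listed_metric_lie_algebra br e1 f1 e2 f2 \<longleftrightarrow>
     metric_R_e2 br e1 f1 e2 f2 \<or>
     metric_R2_aff br e1 f1 e2 f2 \<or>
     (\<exists>l>0. metric_r4_prime br e1 f1 e2 f2 l) \<or>
     metric_aff_aff br e1 f1 e2 f2"

end

theory Submission
  imports Defs
begin

text \<open>The symmetric endomorphism \<open>H\<^sup>2\<close> has exactly two eigenvalues \<open>- a1\<^sup>2 \<noteq> - a2\<^sup>2\<close>, and its
  eigenspaces are two orthogonal \<open>H\<close>-invariant planes (\<open>exists_adapted_frame\<close>). A parallel \<open>H\<close>
  makes each \<open>\<nabla>\<^sub>x\<close> preserve both planes, so \<open>\<nabla>\<^sub>x = p x J1 + q x J2\<close>, where \<open>p\<close> and \<open>q\<close> are real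
  functions of \<open>x\<close> and \<open>J1\<close>, \<open>J2\<close> are the rotations by a right angle in the planes. As the
  connection is torsion-free, \<open>p\<close> and \<open>q\<close> determine the bracket
  (\<open>brackets_in_adapted_frame\<close>). Rotating each plane makes \<open>[e1, f1] = a f1\<close> and
  \<open>[e2, f2] = b f2\<close> with \<open>a, b \<ge> 0\<close>; the four remaining coefficients \<open>c, d, m, n\<close> describe how
  the planes act on each other.

  The Jacobi identity consists of quadratic equations (\<open>jacobi_relations\<close>), four of which say
  that \<open>(a\<^sup>2 + m\<^sup>2) (c\<^sup>2 + d\<^sup>2) = 0\<close> and \<open>(b\<^sup>2 + c\<^sup>2) (m\<^sup>2 + n\<^sup>2) = 0\<close>. So either neither plane
  acts on the other, and the algebra is a product of algebras of the planes
  (\<open>classified_affine\<close>), or exactly one of them acts, by rotations, on the other one, which is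
  then abelian (\<open>classified_rotational\<close>). Rescaling both planes gives the listed forms.

  Conversely, all listed brackets belong to one family with orthogonal invariant planes, for
  which the Koszul formula in coordinates shows that \<open>H\<close> is parallel
  (\<open>block_rotation_parallel\<close>).\<close>

section \<open>Orthonormal frames adapted to a skew-symmetric endomorphism\<close>

lemma gram_diag_inner:
  assumes "gram_diag e1 f1 e2 f2 d1 d2 d3 d4"
  shows "e1 \<bullet> e1 = d1" "f1 \<bullet> f1 = d2" "e2 \<bullet> e2 = d3" "f2 \<bullet> f2 = d4"
    "e1 \<bullet> f1 = 0" "e1 \<bullet> e2 = 0" "e1 \<bullet> f2 = 0" "f1 \<bullet> e2 = 0" "f1 \<bullet> f2 = 0" "e2 \<bullet> f2 = 0"
    "f1 \<bullet> e1 = 0" "e2 \<bullet> e1 = 0" "f2 \<bullet> e1 = 0" "e2 \<bullet> f1 = 0" "f2 \<bullet> f1 = 0" "f2 \<bullet> e2 = 0"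
  using assms by (auto simp: gram_diag_def inner_commute)

lemma gram_diag_imp_orthogonal_basis4:
  fixes e1 f1 e2 f2 :: "'a::euclidean_space"
  assumes dim: "DIM('a) = 4" and g: "gram_diag e1 f1 e2 f2 d1 d2 d3 d4"
    and pos: "d1 > 0" "d2 > 0" "d3 > 0" "d4 > 0"
  shows "orthogonal_basis4 e1 f1 e2 f2"
proof -
  let ?B = "{e1, f1, e2, f2}"
  have orth: "pairwise orthogonal ?B"
    using g by (auto simp: gram_diag_def pairwise_def orthogonal_def inner_commute)
  have nz: "0 \<notin> ?B"
    using g pos by (auto simp: gram_diag_def)
  have dist: "distinct [e1, f1, e2, f2]"
    using g pos by (auto simp: gram_diag_def)
  have ind: "independent ?B"
    using pairwise_orthogonal_independent[OF orth nz] .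
  have "card ?B = 4"
    using dist by simp
  then have "UNIV \<subseteq> span ?B"
    using ind by (intro card_ge_dim_independent) (auto simp: dim_UNIV dim)
  then show ?thesis
    using orth ind dist by (auto simp: orthogonal_basis4_def basis4_def)
qed

lemma orthogonal_basis4_expansion:
  fixes e1 f1 e2 f2 :: "'a::euclidean_space"
  assumes "orthogonal_basis4 e1 f1 e2 f2"
  obtains x1 x2 x3 x4 where "x = x1 *\<^sub>R e1 + x2 *\<^sub>R f1 + x3 *\<^sub>R e2 + x4 *\<^sub>R f2"
proof -
  have "x \<in> span {e1, f1, e2, f2}"
    using assms by (auto simp: orthogonal_basis4_def basis4_def)
  then obtain k1 k2 k3 k4 where
    "x - k1 *\<^sub>R e1 - k2 *\<^sub>R f1 - k3 *\<^sub>R e2 - k4 *\<^sub>R f2 = 0"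
    by (auto simp: span_breakdown_eq)
  then have "x = k1 *\<^sub>R e1 + k2 *\<^sub>R f1 + k3 *\<^sub>R e2 + k4 *\<^sub>R f2"
    by (simp add: algebra_simps)
  then show thesis by (rule that)
qed

lemma gram_diag_1_expansion:
  fixes e1 f1 e2 f2 :: "'a::euclidean_space"
  assumes dim: "DIM('a) = 4" and g: "gram_diag e1 f1 e2 f2 1 1 1 1"
  shows "x = (x \<bullet> e1) *\<^sub>R e1 + (x \<bullet> f1) *\<^sub>R f1 + (x \<bullet> e2) *\<^sub>R e2 + (x \<bullet> f2) *\<^sub>R f2"
proof -
  have "orthogonal_basis4 e1 f1 e2 f2"
    by (rule gram_diag_imp_orthogonal_basis4[OF dim g]) simp_all
  then obtain x1 x2 x3 x4 where x: "x = x1 *\<^sub>R e1 + x2 *\<^sub>R f1 + x3 *\<^sub>R e2 + x4 *\<^sub>R f2"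
    by (rule orthogonal_basis4_expansion)
  have "x \<bullet> e1 = x1" "x \<bullet> f1 = x2" "x \<bullet> e2 = x3" "x \<bullet> f2 = x4"
    unfolding x by (simp_all add: inner_add_left gram_diag_inner[OF g])
  then show ?thesis
    using x by simp
qed

lemma exists_unit_orthogonal:
  fixes S :: "'a::euclidean_space set"
  assumes "finite S" "card S < DIM('a)"
  obtains u where "u \<bullet> u = 1" "\<And>y. y \<in> S \<Longrightarrow> u \<bullet> y = 0"
proof -
  have "dim S < DIM('a)"
    using dim_le_card'[of S] assms by linarith
  then obtain x where x: "x \<noteq> 0" "\<And>y. y \<in> span S \<Longrightarrow> orthogonal x y"
    using orthogonal_to_subspace_exists by blast
  show thesis
  proof (rule that[of "x /\<^sub>R norm x"])
    show "(x /\<^sub>R norm x) \<bullet> (x /\<^sub>R norm x) = 1"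
      using x(1) by (simp add: dot_square_norm power2_eq_square)
    show "(x /\<^sub>R norm x) \<bullet> y = 0" if "y \<in> S" for y
      using x(2)[OF span_base[OF that]] by (simp add: orthogonal_def)
  qed
qed

lemma exists_norm_maximizer:
  fixes H :: "'a::euclidean_space \<Rightarrow> 'a"
  assumes "linear H"
  obtains u where "u \<bullet> u = 1" "\<And>x. H x \<bullet> H x \<le> (H u \<bullet> H u) * (x \<bullet> x)"
proof -
  have "\<exists>u\<in>sphere 0 1. \<forall>x\<in>sphere 0 1. norm (H x) \<le> norm (H u)"
    using assms
    by (intro continuous_attains_sup compact_sphere continuous_on_norm linear_continuous_on)
       (auto simp: linear_conv_bounded_linear)
  then obtain u where u: "norm u = 1" "\<And>x. norm x = 1 \<Longrightarrow> norm (H x) \<le> norm (H u)"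
    by auto
  have "norm (H x) \<le> norm (H u) * norm x" for x
  proof (cases "x = 0")
    case True
    then show ?thesis by (simp add: linear_0[OF assms])
  next
    case False
    have "norm (H (x /\<^sub>R norm x)) \<le> norm (H u)"
      using False by (intro u(2)) simp
    then show ?thesis
      using False by (simp add: linear_scale[OF assms] field_simps)
  qed
  then have "(norm (H x))\<^sup>2 \<le> (norm (H u) * norm x)\<^sup>2" for x
    by (rule power_mono) simp
  with u(1) show thesis
    by (intro that[of u]) (auto simp: dot_square_norm power_mult_distrib)
qed

lemma nonneg_quadratic_imp_linear_coeff_zero:
  fixes A B :: real
  assumes "\<And>t. 0 \<le> A * t\<^sup>2 + B * t"
  shows "B = 0"
proof (rule ccontr)
  assume B: "B \<noteq> 0"
  define k where "k = \<bar>A\<bar> + 1"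
  have k: "k > 0" "A < k" by (auto simp: k_def)
  have "A * (- B / k)\<^sup>2 + B * (- B / k) = (B\<^sup>2 / k\<^sup>2) * (A - k)"
    using k by (simp add: field_simps power2_eq_square)
  moreover have "\<dots> < 0"
    using k B by (intro mult_pos_neg) auto
  ultimately show False
    using assms[of "- B / k"] by linarith
qed

text \<open>An orthonormal frame that splits \<open>H\<close> into two plane rotations of different speeds.\<close>

definition adapted_frame ::
    "('a::euclidean_space \<Rightarrow> 'a) \<Rightarrow> 'a \<Rightarrow> 'a \<Rightarrow> 'a \<Rightarrow> 'a \<Rightarrow> bool" where
  "adapted_frame H e1 f1 e2 f2 \<longleftrightarrow>
     gram_diag e1 f1 e2 f2 1 1 1 1 \<and>
     (\<exists>a1 a2. \<bar>a1\<bar> \<noteq> \<bar>a2\<bar> \<and> block_rotation H e1 f1 e2 f2 a1 a2)"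

text \<open>A unit vector \<open>e1\<close> maximizing \<open>norm (H x)\<close> is an eigenvector of \<open>H\<^sup>2\<close>; \<open>e1\<close> and
  \<open>H e1\<close> span an invariant plane, and the orthogonal plane is then invariant as well.\<close>

lemma exists_adapted_frame:
  fixes H :: "'a::euclidean_space \<Rightarrow> 'a"
  assumes dim: "DIM('a) = 4" and sk: "skew_symmetric H"
    and nm: "\<not> multiple_of_complex_structure H"
  obtains e1 f1 e2 f2 where "adapted_frame H e1 f1 e2 f2"
proof -
  have lin: "linear H" and skew: "H x \<bullet> y = - (x \<bullet> H y)" for x y
    using sk by (auto simp: skew_symmetric_def)
  have self: "H x \<bullet> x = 0" for x
    using skew[of x x] by (simp add: inner_commute)
  obtain e1 where e1: "e1 \<bullet> e1 = 1" and
    max: "\<And>x. H x \<bullet> H x \<le> (H e1 \<bullet> H e1) * (x \<bullet> x)"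
    using exists_norm_maximizer[OF lin] by blast
  \<comment> \<open>The first variation of \<open>norm (H x)\<close> at the maximizer \<open>e1\<close> vanishes.\<close>
  have crit: "H e1 \<bullet> H y = 0" if y: "y \<bullet> e1 = 0" for y
  proof -
    have "0 \<le> ((H e1 \<bullet> H e1) * (y \<bullet> y) - H y \<bullet> H y) * t\<^sup>2 + (- 2 * (H e1 \<bullet> H y)) * t" for t
      using max[of "e1 + t *\<^sub>R y"] y e1
      by (simp add: linear_add[OF lin] linear_scale[OF lin] inner_add_left inner_add_right
          inner_commute algebra_simps power2_eq_square)
    from nonneg_quadratic_imp_linear_coeff_zero[OF this] show ?thesis by simp
  qed
  define a1 where "a1 = norm (H e1)"
  have a1: "a1 > 0"
  proof (rule ccontr)
    assume "\<not> a1 > 0"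
    then have "H e1 = 0" by (simp add: a1_def)
    then have "H x \<bullet> H x \<le> 0" for x
      using max[of x] by simp
    then have "H x = 0" for x
      by (meson inner_gt_zero_iff not_less)
    then have "\<forall>x. H (H x) = - (0\<^sup>2) *\<^sub>R x" by simp
    then show False
      using nm unfolding multiple_of_complex_structure_def by blast
  qed
  define f1 where "f1 = H e1 /\<^sub>R a1"
  have He1: "H e1 = a1 *\<^sub>R f1"
    using a1 by (simp add: f1_def)
  have f1: "f1 \<bullet> f1 = 1"
    using a1 by (simp add: f1_def a1_def dot_square_norm power2_eq_square)
  have e1f1: "e1 \<bullet> f1 = 0"
    using self[of e1] by (simp add: f1_def inner_commute)
  obtain e2 where e2: "e2 \<bullet> e2 = 1" "\<And>y. y \<in> {e1, f1} \<Longrightarrow> e2 \<bullet> y = 0"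
    by (rule exists_unit_orthogonal[of "{e1, f1}"])
       (use dim card_insert_le_m1[of 2 "{f1}" e1] in auto)
  obtain f2 where f2: "f2 \<bullet> f2 = 1" "\<And>y. y \<in> {e1, f1, e2} \<Longrightarrow> f2 \<bullet> y = 0"
    by (rule exists_unit_orthogonal[of "{e1, f1, e2}"])
       (use dim card_length[of "[e1, f1, e2]"] in auto)
  have g: "gram_diag e1 f1 e2 f2 1 1 1 1"
    using e1 f1 e1f1 e2(1) e2(2)[of e1] e2(2)[of f1] f2(1) f2(2)[of e1] f2(2)[of f1] f2(2)[of e2]
    by (simp add: gram_diag_def inner_commute)
  note ex = gram_diag_1_expansion[OF dim g]
  have perp: "H y \<bullet> f1 = 0" if "y \<bullet> e1 = 0" for y
    using crit[OF that] a1 by (simp add: He1 inner_commute)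
  have Hf1: "H f1 = - a1 *\<^sub>R e1"
  proof -
    have "H f1 \<bullet> e1 = - a1"
      using skew[of f1 e1] f1 by (simp add: He1)
    moreover have "H f1 \<bullet> e2 = 0" "H f1 \<bullet> f2 = 0"
      using skew[of f1 e2] skew[of f1 f2] perp[of e2] perp[of f2] e2 f2
      by (auto simp: inner_commute)
    ultimately show ?thesis
      using ex[of "H f1"] self[of f1] by simp
  qed
  define a2 where "a2 = H e2 \<bullet> f2"
  have He2: "H e2 = a2 *\<^sub>R f2"
    using ex[of "H e2"] self[of e2] perp[of e2] e2 skew[of e2 e1] by (simp add: He1 a2_def)
  have Hf2: "H f2 = - a2 *\<^sub>R e2"
    using ex[of "H f2"] self[of f2] perp[of f2] f2 skew[of f2 e1] skew[of f2 e2]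
    by (simp add: He1 a2_def inner_commute)
  have "\<bar>a1\<bar> \<noteq> \<bar>a2\<bar>"
  proof
    assume "\<bar>a1\<bar> = \<bar>a2\<bar>"
    then have "a2 * a2 = a1 * a1"
      by (metis abs_mult_self_eq)
    then have sq: "a2 * (a2 * w) = a1 * (a1 * w)" for w
      by (simp flip: mult.assoc)
    have "H (H x) = - (a1\<^sup>2) *\<^sub>R x" for x
    proof -
      obtain x1 x2 x3 x4 where x: "x = x1 *\<^sub>R e1 + x2 *\<^sub>R f1 + x3 *\<^sub>R e2 + x4 *\<^sub>R f2"
        using ex by blast
      show ?thesis
        unfolding x
        by (simp add: linear_add[OF lin] linear_scale[OF lin] linear_neg[OF lin]
            linear_diff[OF lin] He1 Hf1 He2 Hf2 sq algebra_simps power2_eq_square)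
    qed
    then show False
      using nm unfolding multiple_of_complex_structure_def by blast
  qed
  then show thesis
    using g He1 Hf1 He2 Hf2 by (intro that) (auto simp: adapted_frame_def block_rotation_def)
qed

lemma adapted_frame_swap:
  assumes "adapted_frame H e1 f1 e2 f2"
  shows "adapted_frame H e2 f2 e1 f1"
proof -
  obtain a1 a2 where a: "\<bar>a1\<bar> \<noteq> \<bar>a2\<bar>" "block_rotation H e1 f1 e2 f2 a1 a2"
    using assms by (auto simp: adapted_frame_def)
  then have "\<bar>a2\<bar> \<noteq> \<bar>a1\<bar> \<and> block_rotation H e2 f2 e1 f1 a2 a1"
    by (auto simp: block_rotation_def)
  then show ?thesis
    using assms by (auto simp: adapted_frame_def gram_diag_def inner_commute)
qed

lemma adapted_frame_flip:
  assumes lin: "linear H" and "adapted_frame H e1 f1 e2 f2"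
  shows "adapted_frame H e1 f1 e2 (- f2)"
proof -
  obtain a1 a2 where a: "\<bar>a1\<bar> \<noteq> \<bar>a2\<bar>" "block_rotation H e1 f1 e2 f2 a1 a2"
    using assms by (auto simp: adapted_frame_def)
  then have "\<bar>a1\<bar> \<noteq> \<bar>- a2\<bar> \<and> block_rotation H e1 f1 e2 (- f2) a1 (- a2)"
    by (auto simp: block_rotation_def linear_neg[OF lin])
  then show ?thesis
    using assms unfolding adapted_frame_def gram_diag_def by (metis inner_minus_left
        inner_minus_right minus_minus minus_zero)
qed

lemma adapted_frame_rotate:
  assumes lin: "linear H" and fr: "adapted_frame H e1 f1 e2 f2" and cs: "c\<^sup>2 + s\<^sup>2 = 1"
  shows "adapted_frame H (c *\<^sub>R e1 + s *\<^sub>R f1) (- s *\<^sub>R e1 + c *\<^sub>R f1) e2 f2"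
proof -
  obtain a1 a2 where a: "\<bar>a1\<bar> \<noteq> \<bar>a2\<bar>" "block_rotation H e1 f1 e2 f2 a1 a2"
    using fr by (auto simp: adapted_frame_def)
  have "block_rotation H (c *\<^sub>R e1 + s *\<^sub>R f1) (- s *\<^sub>R e1 + c *\<^sub>R f1) e2 f2 a1 a2"
    using a(2)
    by (simp add: block_rotation_def linear_add[OF lin] linear_diff[OF lin] linear_neg[OF lin]
        linear_scale[OF lin] algebra_simps)
  moreover have "gram_diag (c *\<^sub>R e1 + s *\<^sub>R f1) (- s *\<^sub>R e1 + c *\<^sub>R f1) e2 f2 1 1 1 1"
    using fr cs
    by (simp add: adapted_frame_def gram_diag_def inner_add_left inner_add_right
        inner_diff_left inner_diff_right inner_commute power2_eq_square algebra_simps)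
  ultimately show ?thesis
    using a(1) unfolding adapted_frame_def by blast
qed

lemma adapted_frame_scale:
  fixes H :: "'a::euclidean_space \<Rightarrow> 'a"
  assumes dim: "DIM('a) = 4" and lin: "linear H" and fr: "adapted_frame H e1 f1 e2 f2"
    and k: "k > 0" and l: "l > 0"
  shows "orthogonal_basis4 (k *\<^sub>R e1) (k *\<^sub>R f1) (l *\<^sub>R e2) (l *\<^sub>R f2)" (is ?b)
    and "\<exists>a1 a2. \<bar>a1\<bar> \<noteq> \<bar>a2\<bar> \<and>
      block_rotation H (k *\<^sub>R e1) (k *\<^sub>R f1) (l *\<^sub>R e2) (l *\<^sub>R f2) a1 a2" (is ?r)
    and "gram_diag (k *\<^sub>R e1) (k *\<^sub>R f1) (l *\<^sub>R e2) (l *\<^sub>R f2) (k\<^sup>2) (k\<^sup>2) (l\<^sup>2) (l\<^sup>2)" (is ?g)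
proof -
  show ?g
    using fr by (simp add: adapted_frame_def gram_diag_def power2_eq_square)
  then show ?b
    by (rule gram_diag_imp_orthogonal_basis4[OF dim]) (use k l in simp_all)
  show ?r
    using fr unfolding adapted_frame_def block_rotation_def linear_scale[OF lin]
    by (metis scaleR_left_commute)
qed

section \<open>The bracket in an adapted frame\<close>

context metric_lie_algebra
begin

lemmas br_lin = bilinear_ladd[OF bilinear_br] bilinear_radd[OF bilinear_br]
  bilinear_lmul[OF bilinear_br] bilinear_rmul[OF bilinear_br]
  bilinear_lneg[OF bilinear_br] bilinear_rneg[OF bilinear_br]
  bilinear_lsub[OF bilinear_br] bilinear_rsub[OF bilinear_br]
  bilinear_lzero[OF bilinear_br] bilinear_rzero[OF bilinear_br]

lemma antisym: "br y x = - br x y"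
proof -
  have "br (x + y) (x + y) = br x y + br y x"
    unfolding br_lin by (simp add: alternating)
  then have "br x y + br y x = 0"
    using alternating[of "x + y"] by simp
  then show ?thesis
    by (simp add: eq_neg_iff_add_eq_0 add.commute)
qed

lemma nabla_metric: "nabla br x y \<bullet> z = - (nabla br x z \<bullet> y)"
  using koszul[OF bilinear_br, of x y z] koszul[OF bilinear_br, of x z y]
  by (simp add: antisym[of x z] antisym[of y z] antisym[of x y])

lemma nabla_torsion_free: "br x y \<bullet> z = nabla br x y \<bullet> z - nabla br y x \<bullet> z"
  using koszul[OF bilinear_br, of x y z] koszul[OF bilinear_br, of y x z]
    antisym[of x z] antisym[of y z] antisym[of x y]
  by simp

text \<open>The endomorphisms \<^term>\<open>nabla br x\<close> commute with \<open>H\<^sup>2\<close>, whose eigenspaces are the two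
  planes of the frame, so they are combinations \<open>p x J1 + q x J2\<close> of the rotations of these
  planes. As the connection is torsion-free, \<open>p\<close> and \<open>q\<close> determine the bracket.\<close>

lemma brackets_in_adapted_frame:
  assumes dim: "DIM('a) = 4" and par: "parallel_skew br H" and fr: "adapted_frame H e1 f1 e2 f2"
  obtains p q :: "'a \<Rightarrow> real" where
    "br e1 f1 = - p e1 *\<^sub>R e1 - p f1 *\<^sub>R f1"
    "br e2 f2 = - q e2 *\<^sub>R e2 - q f2 *\<^sub>R f2"
    "br e1 e2 = q e1 *\<^sub>R f2 - p e2 *\<^sub>R f1"
    "br e1 f2 = - q e1 *\<^sub>R e2 - p f2 *\<^sub>R f1"
    "br f1 e2 = q f1 *\<^sub>R f2 + p e2 *\<^sub>R e1"
    "br f1 f2 = - q f1 *\<^sub>R e2 + p f2 *\<^sub>R e1"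
proof -
  have g: "gram_diag e1 f1 e2 f2 1 1 1 1"
    using fr by (simp add: adapted_frame_def)
  obtain a1 a2 where a: "\<bar>a1\<bar> \<noteq> \<bar>a2\<bar>" and bl: "block_rotation H e1 f1 e2 f2 a1 a2"
    using fr by (auto simp: adapted_frame_def)
  have lin: "linear H" and skew: "\<And>x y. H x \<bullet> y = - (x \<bullet> H y)"
    and com: "\<And>x y. nabla br x (H y) = H (nabla br x y)"
    using par by (auto simp: parallel_skew_def skew_symmetric_def)
  have a': "a1\<^sup>2 \<noteq> a2\<^sup>2"
    using a by (simp add: power2_eq_iff abs_eq_iff)
  have sq: "H (H e1) = - (a1\<^sup>2) *\<^sub>R e1" "H (H f1) = - (a1\<^sup>2) *\<^sub>R f1"
    "H (H e2) = - (a2\<^sup>2) *\<^sub>R e2" "H (H f2) = - (a2\<^sup>2) *\<^sub>R f2"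
    using bl by (simp_all add: block_rotation_def linear_scale[OF lin] linear_neg[OF lin]
        power2_eq_square)
  have mixed: "nabla br x u \<bullet> v = 0" "nabla br x v \<bullet> u = 0"
    if u: "H (H u) = - (a1\<^sup>2) *\<^sub>R u" and v: "H (H v) = - (a2\<^sup>2) *\<^sub>R v" for x u v
  proof -
    have "nabla br x (H (H u)) \<bullet> v = nabla br x u \<bullet> H (H v)"
      by (simp add: com skew)
    moreover have "nabla br x (H (H u)) \<bullet> v = - (nabla br x v \<bullet> H (H u))"
      by (rule nabla_metric)
    ultimately have "a1\<^sup>2 * (nabla br x u \<bullet> v) = a2\<^sup>2 * (nabla br x u \<bullet> v)"
      by (simp only: nabla_metric[of x v u] u v inner_scaleR_right)
    then show "nabla br x u \<bullet> v = 0"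
      using a' by auto
    then show "nabla br x v \<bullet> u = 0"
      using nabla_metric[of x v u] by simp
  qed
  have self: "nabla br x u \<bullet> u = 0" for x u
    using nabla_metric[of x u u] by simp
  note m = mixed[OF sq(1) sq(3)] mixed[OF sq(1) sq(4)] mixed[OF sq(2) sq(3)] mixed[OF sq(2) sq(4)]
  define p q where "p x = nabla br x e1 \<bullet> f1" and "q x = nabla br x e2 \<bullet> f2" for x
  have pq: "nabla br x e1 \<bullet> f1 = p x" "nabla br x f1 \<bullet> e1 = - p x"
    "nabla br x e2 \<bullet> f2 = q x" "nabla br x f2 \<bullet> e2 = - q x" for x
    using nabla_metric[of x f1 e1] nabla_metric[of x f2 e2] by (simp_all add: p_def q_def)
  note ex = gram_diag_1_expansion[OF dim g]
  note t = nabla_torsion_free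
  show thesis
  proof (rule that[of p q])
    show "br e1 f1 = - p e1 *\<^sub>R e1 - p f1 *\<^sub>R f1"
      using ex[of "br e1 f1"] by (simp add: t m self pq)
    show "br e2 f2 = - q e2 *\<^sub>R e2 - q f2 *\<^sub>R f2"
      using ex[of "br e2 f2"] by (simp add: t m self pq)
    show "br e1 e2 = q e1 *\<^sub>R f2 - p e2 *\<^sub>R f1"
      using ex[of "br e1 e2"] by (simp add: t m self pq)
    show "br e1 f2 = - q e1 *\<^sub>R e2 - p f2 *\<^sub>R f1"
      using ex[of "br e1 f2"] by (simp add: t m self pq)
    show "br f1 e2 = q f1 *\<^sub>R f2 + p e2 *\<^sub>R e1"
      using ex[of "br f1 e2"] by (simp add: t m self pq)
    show "br f1 f2 = - q f1 *\<^sub>R e2 + p f2 *\<^sub>R e1"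
      using ex[of "br f1 f2"] by (simp add: t m self pq)
  qed
qed

text \<open>Since \<open>[e1, f1]\<close> lies in the plane of \<open>e1\<close> and \<open>f1\<close> and is invariant under rotations of
  this plane, a rotation turns it into a nonnegative multiple of \<open>f1\<close>.\<close>

lemma exists_frame_normalizing_first_plane:
  assumes dim: "DIM('a) = 4" and par: "parallel_skew br H" and fr: "adapted_frame H e1 f1 e2 f2"
  obtains u v a where "adapted_frame H u v e2 f2" "br u v = a *\<^sub>R v" "a \<ge> 0"
proof -
  obtain p q :: "'a \<Rightarrow> real" where pq: "br e1 f1 = - p e1 *\<^sub>R e1 - p f1 *\<^sub>R f1"
    by (rule brackets_in_adapted_frame[OF dim par fr])
  define r where "r = sqrt ((p e1)\<^sup>2 + (p f1)\<^sup>2)"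
  have lin: "linear H"
    using par by (simp add: parallel_skew_def skew_symmetric_def)
  show thesis
  proof (cases "r = 0")
    case True
    then have "br e1 f1 = 0 *\<^sub>R f1"
      by (simp add: pq r_def sum_power2_eq_zero_iff)
    then show thesis
      using that[OF fr, of 0] by simp
  next
    case False
    have r2: "r * r = p e1 * p e1 + p f1 * p f1"
      by (simp add: r_def flip: power2_eq_square)
    then have nz: "p e1 * p e1 + p f1 * p f1 \<noteq> 0"
      using False by (metis mult_eq_0_iff)
    define c s where "c = - p f1 / r" and "s = p e1 / r"
    have cs: "c\<^sup>2 + s\<^sup>2 = 1"
      using nz by (simp add: c_def s_def power_divide r2 power2_eq_square
          flip: add_divide_distrib)
    have p: "p e1 = r * s" "p f1 = - (r * c)"
      using False by (simp_all add: c_def s_def)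
    have "br (c *\<^sub>R e1 + s *\<^sub>R f1) (- s *\<^sub>R e1 + c *\<^sub>R f1) = (c\<^sup>2 + s\<^sup>2) *\<^sub>R br e1 f1"
      by (simp add: br_lin alternating antisym[of f1 e1] algebra_simps power2_eq_square)
    also have "\<dots> = r *\<^sub>R (- s *\<^sub>R e1 + c *\<^sub>R f1)"
      by (simp add: cs pq p algebra_simps)
    finally show thesis
      using that[OF adapted_frame_rotate[OF lin fr cs], of r] by (simp add: r_def)
  qed
qed

end

text \<open>The form that the bracket takes once \<open>[e1, f1]\<close> and \<open>[e2, f2]\<close> are multiples of \<open>f1\<close>
  and \<open>f2\<close>: \<open>m\<close> and \<open>n\<close> give the rotations of the second plane by \<open>e1\<close> and \<open>f1\<close>, and \<open>c\<close> and
  \<open>d\<close> those of the first plane by \<open>e2\<close> and \<open>f2\<close>.\<close>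

definition bracket_table ::
    "('a::euclidean_space \<Rightarrow> 'a \<Rightarrow> 'a) \<Rightarrow> 'a \<Rightarrow> 'a \<Rightarrow> 'a \<Rightarrow> 'a \<Rightarrow>
      real \<Rightarrow> real \<Rightarrow> real \<Rightarrow> real \<Rightarrow> real \<Rightarrow> real \<Rightarrow> bool" where
  "bracket_table br e1 f1 e2 f2 a b c d m n \<longleftrightarrow>
     br e1 f1 = a *\<^sub>R f1 \<and> br e2 f2 = b *\<^sub>R f2 \<and>
     br e1 e2 = m *\<^sub>R f2 - c *\<^sub>R f1 \<and> br e1 f2 = - m *\<^sub>R e2 - d *\<^sub>R f1 \<and>
     br f1 e2 = n *\<^sub>R f2 + c *\<^sub>R e1 \<and> br f1 f2 = - n *\<^sub>R e2 + d *\<^sub>R e1"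

context metric_lie_algebra
begin

lemma exists_bracket_table:
  assumes dim: "DIM('a) = 4" and par: "parallel_skew br H"
    and nm: "\<not> multiple_of_complex_structure H"
  obtains e1 f1 e2 f2 a b c d m n where "adapted_frame H e1 f1 e2 f2"
    "bracket_table br e1 f1 e2 f2 a b c d m n" "a \<ge> 0" "b \<ge> 0"
proof -
  have sk: "skew_symmetric H"
    using par by (simp add: parallel_skew_def)
  obtain u1 v1 u2 v2 where "adapted_frame H u1 v1 u2 v2"
    by (rule exists_adapted_frame[OF dim sk nm])
  then obtain e1 f1 a where 1: "adapted_frame H e1 f1 u2 v2" "br e1 f1 = a *\<^sub>R f1" "a \<ge> 0"
    by (rule exists_frame_normalizing_first_plane[OF dim par])
  obtain e2 f2 b where 2: "adapted_frame H e2 f2 e1 f1" "br e2 f2 = b *\<^sub>R f2" "b \<ge> 0"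
    by (rule exists_frame_normalizing_first_plane[OF dim par adapted_frame_swap[OF 1(1)]])
  have fr: "adapted_frame H e1 f1 e2 f2"
    by (rule adapted_frame_swap[OF 2(1)])
  obtain p q :: "'a \<Rightarrow> real" where
    "br e1 e2 = q e1 *\<^sub>R f2 - p e2 *\<^sub>R f1"
    "br e1 f2 = - q e1 *\<^sub>R e2 - p f2 *\<^sub>R f1"
    "br f1 e2 = q f1 *\<^sub>R f2 + p e2 *\<^sub>R e1"
    "br f1 f2 = - q f1 *\<^sub>R e2 + p f2 *\<^sub>R e1"
    by (rule brackets_in_adapted_frame[OF dim par fr])
  then have "bracket_table br e1 f1 e2 f2 a b (p e2) (p f2) (q e1) (q f1)"
    using 1 2 by (simp add: bracket_table_def)
  then show thesis
    using that fr 1 2 by blast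
qed

lemma bracket_table_swap:
  assumes "bracket_table br e1 f1 e2 f2 a b c d m n"
  shows "bracket_table br e2 f2 e1 f1 b a m n c d"
  using assms
  by (simp add: bracket_table_def antisym[of e2 e1] antisym[of e2 f1] antisym[of f2 e1]
      antisym[of f2 f1])

text \<open>The relations come from the Jacobi identity for \<open>e1, f1, e2\<close> and for \<open>e1, f1, f2\<close>; the
  other two triples give the same relations with the planes exchanged.\<close>

lemma jacobi_relations_first_plane:
  assumes g: "gram_diag e1 f1 e2 f2 1 1 1 1" and t: "bracket_table br e1 f1 e2 f2 a b c d m n"
  shows "a * c + m * d = 0" "a * d - m * c = 0" "a * n = 0" "c * n = 0" "d * n = 0"
proof -
  note br = t[unfolded bracket_table_def]
  note as = antisym[of f1 e1] antisym[of e2 e1] antisym[of f2 e1] antisym[of e2 f1] antisym[of f2 f1]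
  have 1: "(a * c + m * d) *\<^sub>R e1 + (d * n) *\<^sub>R f1 + (a * n) *\<^sub>R f2 = 0" (is "?v = 0")
  proof -
    have "br e1 (br f1 e2) + br f1 (br e2 e1) + br e2 (br e1 f1) = - ?v"
      by (simp add: br as br_lin alternating algebra_simps)
    then show ?thesis
      using jacobi[of e1 f1 e2] by (metis neg_equal_0_iff_equal)
  qed
  have 2: "(a * d - m * c) *\<^sub>R e1 - (c * n) *\<^sub>R f1 - (a * n) *\<^sub>R e2 = 0" (is "?w = 0")
  proof -
    have "br e1 (br f1 f2) + br f1 (br f2 e1) + br f2 (br e1 f1) = - ?w"
      by (simp add: br as br_lin alternating algebra_simps)
    then show ?thesis
      using jacobi[of e1 f1 f2] by (metis neg_equal_0_iff_equal)
  qed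
  have "?v \<bullet> e1 = 0" "?v \<bullet> f1 = 0" "?v \<bullet> f2 = 0" "?w \<bullet> e1 = 0" "?w \<bullet> f1 = 0"
    unfolding 1 2 by simp_all
  then show "a * c + m * d = 0" "a * d - m * c = 0" "a * n = 0" "c * n = 0" "d * n = 0"
    by (simp_all add: inner_add_left inner_diff_left gram_diag_inner[OF g])
qed

lemma jacobi_relations:
  assumes g: "gram_diag e1 f1 e2 f2 1 1 1 1" and t: "bracket_table br e1 f1 e2 f2 a b c d m n"
  shows "a * c + m * d = 0" "a * d - m * c = 0" "b * m + c * n = 0" "b * n - c * m = 0"
    "a * n = 0" "b * d = 0" "c * n = 0" "d * n = 0"
proof -
  have g': "gram_diag e2 f2 e1 f1 1 1 1 1"
    using g by (simp add: gram_diag_def inner_commute)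
  show "a * c + m * d = 0" "a * d - m * c = 0" "b * m + c * n = 0" "b * n - c * m = 0"
    "a * n = 0" "b * d = 0" "c * n = 0" "d * n = 0"
    by (fact jacobi_relations_first_plane[OF g t]
      jacobi_relations_first_plane[OF g' bracket_table_swap[OF t]])+
qed

end

section \<open>Classification\<close>

text \<open>Some orthogonal basis puts both \<open>H\<close> and the metric Lie algebra into normal form.\<close>

definition classified ::
    "('a::euclidean_space \<Rightarrow> 'a \<Rightarrow> 'a) \<Rightarrow> ('a \<Rightarrow> 'a) \<Rightarrow> bool" where
  "classified br H \<longleftrightarrow>
     (\<exists>e1 f1 e2 f2. orthogonal_basis4 e1 f1 e2 f2 \<and>
        (\<exists>a1 a2. \<bar>a1\<bar> \<noteq> \<bar>a2\<bar> \<and> block_rotation H e1 f1 e2 f2 a1 a2) \<and>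
        listed_metric_lie_algebra br e1 f1 e2 f2)"

context metric_lie_algebra
begin

text \<open>If \<open>a = 0\<close>, both planes are scaled by \<open>1 / b\<close>. Otherwise they are scaled by \<open>1 / a\<close> and
  \<open>1 / b\<close>, so the ratio \<open>s\<close> of the squared lengths is
  \<open>a\<^sup>2 / b\<^sup>2\<close>; the assumption \<open>a \<le> b\<close> makes it at most \<open>1\<close>.\<close>

lemma classified_affine_ordered:
  assumes dim: "DIM('a) = 4" and lin: "linear H" and fr: "adapted_frame H e1 f1 e2 f2"
    and t: "bracket_table br e1 f1 e2 f2 a b 0 0 0 0" and ab: "0 \<le> a" "a \<le> b" "0 < b"
  shows "classified br H"
proof (cases "a = 0")
  case True
  define k where "k = 1 / b"
  have k: "k > 0" "b * k = 1"
    using ab by (simp_all add: k_def)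
  note sc = adapted_frame_scale[OF dim lin fr k(1) k(1)]
  have "br (k *\<^sub>R e2) (k *\<^sub>R f2) = k *\<^sub>R f2"
    using t k by (simp add: bracket_table_def br_lin mult.commute)
  then have "metric_R2_aff br (k *\<^sub>R e1) (k *\<^sub>R f1) (k *\<^sub>R e2) (k *\<^sub>R f2)"
    unfolding metric_R2_aff_def using t True k
    by (intro conjI exI[of _ "k\<^sup>2"] sc(3)) (simp_all add: bracket_table_def br_lin)
  then show ?thesis
    using sc unfolding classified_def listed_metric_lie_algebra_def by blast
next
  case False
  define k l where "k = 1 / a" and "l = 1 / b"
  have k: "k > 0" "a * k = 1" and l: "l > 0" "b * l = 1"
    using ab False by (simp_all add: k_def l_def)
  note sc = adapted_frame_scale[OF dim lin fr k(1) l(1)]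
  have br: "br (k *\<^sub>R e1) (k *\<^sub>R f1) = k *\<^sub>R f1" "br (l *\<^sub>R e2) (l *\<^sub>R f2) = l *\<^sub>R f2"
    using t k l by (simp_all add: bracket_table_def br_lin mult.commute)
  have s: "0 < a\<^sup>2 / b\<^sup>2" "a\<^sup>2 / b\<^sup>2 \<le> 1" "k\<^sup>2 * (a\<^sup>2 / b\<^sup>2) = l\<^sup>2"
    using ab False by (simp_all add: k_def l_def power_mono power_divide)
  have "metric_aff_aff br (k *\<^sub>R e1) (k *\<^sub>R f1) (l *\<^sub>R e2) (l *\<^sub>R f2)"
    unfolding metric_aff_aff_def using t s sc(3) br k
    by (intro conjI exI[of _ "k\<^sup>2"] exI[of _ "a\<^sup>2 / b\<^sup>2"])
       (simp_all add: bracket_table_def br_lin del: scaleR_scaleR)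
  then show ?thesis
    using sc unfolding classified_def listed_metric_lie_algebra_def by blast
qed

lemma classified_affine:
  assumes dim: "DIM('a) = 4" and lin: "linear H" and fr: "adapted_frame H e1 f1 e2 f2"
    and t: "bracket_table br e1 f1 e2 f2 a b 0 0 0 0"
    and ab: "0 \<le> a" "0 \<le> b" "a \<noteq> 0 \<or> b \<noteq> 0"
  shows "classified br H"
proof (cases "a \<le> b")
  case True
  then show ?thesis
    using classified_affine_ordered[OF dim lin fr t] ab by linarith
next
  case False
  then show ?thesis
    using classified_affine_ordered[OF dim lin adapted_frame_swap[OF fr] bracket_table_swap[OF t]] ab
    by linarith
qed

text \<open>Scaling all vectors by \<open>- 1 / m\<close> gives \<open>\<real> \<times> e(2)\<close> for \<open>a = 0\<close>, and \<open>r'\<^sub>4\<close> with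
  \<open>\<lambda> = - a / m\<close> for \<open>a > 0\<close>.\<close>

lemma classified_rotational_negative:
  assumes dim: "DIM('a) = 4" and lin: "linear H" and fr: "adapted_frame H e1 f1 e2 f2"
    and t: "bracket_table br e1 f1 e2 f2 a 0 0 0 m 0" and "a \<ge> 0" "m < 0"
  shows "classified br H"
proof -
  define k where "k = - (1 / m)"
  have k: "k > 0" "m * k = -1"
    using \<open>m < 0\<close> by (simp_all add: k_def)
  note sc = adapted_frame_scale[OF dim lin fr k(1) k(1)]
  have br: "br (k *\<^sub>R e1) (k *\<^sub>R f1) = (a * k) *\<^sub>R (k *\<^sub>R f1)"
    "br (k *\<^sub>R e1) (k *\<^sub>R e2) = - (k *\<^sub>R f2)" "br (k *\<^sub>R e1) (k *\<^sub>R f2) = k *\<^sub>R e2"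
    "br (k *\<^sub>R f1) (k *\<^sub>R e2) = 0" "br (k *\<^sub>R f1) (k *\<^sub>R f2) = 0"
    "br (k *\<^sub>R e2) (k *\<^sub>R f2) = 0"
    using t k by (simp_all add: bracket_table_def br_lin mult_ac)
  have gr: "\<exists>t>0. gram_diag (k *\<^sub>R e1) (k *\<^sub>R f1) (k *\<^sub>R e2) (k *\<^sub>R f2) t t t t"
    using sc(3) k by (intro exI[of _ "k\<^sup>2"]) simp
  have "listed_metric_lie_algebra br (k *\<^sub>R e1) (k *\<^sub>R f1) (k *\<^sub>R e2) (k *\<^sub>R f2)"
  proof (cases "a = 0")
    case True
    then have "metric_R_e2 br (k *\<^sub>R e1) (k *\<^sub>R f1) (k *\<^sub>R e2) (k *\<^sub>R f2)"
      using br gr by (simp add: metric_R_e2_def)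
    then show ?thesis
      by (simp add: listed_metric_lie_algebra_def)
  next
    case False
    then have "a * k > 0"
      using \<open>a \<ge> 0\<close> k by simp
    moreover have "metric_r4_prime br (k *\<^sub>R e1) (k *\<^sub>R f1) (k *\<^sub>R e2) (k *\<^sub>R f2) (a * k)"
      unfolding metric_r4_prime_def using br gr by blast
    ultimately show ?thesis
      unfolding listed_metric_lie_algebra_def by blast
  qed
  then show ?thesis
    using sc unfolding classified_def by blast
qed

lemma classified_rotational_nonzero:
  assumes dim: "DIM('a) = 4" and lin: "linear H" and fr: "adapted_frame H e1 f1 e2 f2"
    and t: "bracket_table br e1 f1 e2 f2 a 0 0 0 m 0" and a: "a \<ge> 0" and m: "m \<noteq> 0"
  shows "classified br H"
proof (cases "m < 0")
  case True
  then show ?thesis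
    using classified_rotational_negative[OF dim lin fr t] a by blast
next
  case False
  \<comment> \<open>Reversing the orientation of the second plane changes the sign of \<open>m\<close>.\<close>
  have "bracket_table br e1 f1 e2 (- f2) a 0 0 0 (- m) 0"
    using t by (simp add: bracket_table_def br_lin)
  then show ?thesis
    using classified_rotational_negative[OF dim lin adapted_frame_flip[OF lin fr]] a m False
    by simp
qed

lemma classified_rotational:
  assumes dim: "DIM('a) = 4" and lin: "linear H" and fr: "adapted_frame H e1 f1 e2 f2"
    and t: "bracket_table br e1 f1 e2 f2 a 0 0 0 m n"
    and a: "a \<ge> 0" and an: "a * n = 0" and mn: "m \<noteq> 0 \<or> n \<noteq> 0"
  shows "classified br H"
proof (cases "n = 0")
  case True
  then show ?thesis
    using classified_rotational_nonzero[OF dim lin fr] t a mn by simp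
next
  case False
  then have a0: "a = 0"
    using an by simp
  \<comment> \<open>The first plane is abelian here and acts on the second one through the linear form with
    coefficients \<open>m\<close>, \<open>n\<close>; the new \<open>f1\<close> spans the kernel of this form.\<close>
  define r where "r = sqrt (m\<^sup>2 + n\<^sup>2)"
  have r0: "r \<noteq> 0"
    using False by (simp add: r_def sum_power2_eq_zero_iff)
  have r2: "r * r = m * m + n * n"
    by (simp add: r_def flip: power2_eq_square)
  then have nz: "m * m + n * n \<noteq> 0"
    using r0 by (metis mult_eq_0_iff)
  define c s where "c = m / r" and "s = n / r"
  have cs: "c\<^sup>2 + s\<^sup>2 = 1"
    using nz by (simp add: c_def s_def power_divide r2 power2_eq_square
        flip: add_divide_distrib)
  have mn: "m = r * c" "n = r * s"
    using r0 by (simp_all add: c_def s_def)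
  have cs': "c * (r * c) + s * (r * s) = r"
    using arg_cong[OF cs, of "\<lambda>x. r * x"] by (simp add: power2_eq_square algebra_simps)
  have "bracket_table br (c *\<^sub>R e1 + s *\<^sub>R f1) (- s *\<^sub>R e1 + c *\<^sub>R f1) e2 f2 0 0 0 0 r 0"
    using t a0 cs' unfolding bracket_table_def mn
    by (simp add: br_lin alternating antisym[of f1 e1] mult_ac
        flip: scaleR_add_left scaleR_minus_left)
  then show ?thesis
    using classified_rotational_nonzero[OF dim lin adapted_frame_rotate[OF lin fr cs]] r0 by simp
qed

lemma abelian_if_zero_table:
  assumes dim: "DIM('a) = 4" and g: "gram_diag e1 f1 e2 f2 1 1 1 1"
    and t: "bracket_table br e1 f1 e2 f2 0 0 0 0 0 0"
  shows "abelian br"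
  unfolding abelian_def
proof (intro allI)
  fix x y
  note ex = gram_diag_1_expansion[OF dim g]
  show "br x y = 0"
    by (subst ex[of x], subst ex[of y])
       (use t in \<open>simp add: bracket_table_def br_lin alternating antisym[of f1 e1]
         antisym[of f2 e2] antisym[of e2 e1] antisym[of e2 f1] antisym[of f2 e1] antisym[of f2 f1]\<close>)
qed

theorem classification:
  assumes dim: "DIM('a) = 4" and na: "\<not> abelian br" and par: "parallel_skew br H"
    and nm: "\<not> multiple_of_complex_structure H"
  shows "classified br H"
proof -
  have lin: "linear H"
    using par by (simp add: parallel_skew_def skew_symmetric_def)
  obtain e1 f1 e2 f2 a b c d m n where fr: "adapted_frame H e1 f1 e2 f2"
    and t: "bracket_table br e1 f1 e2 f2 a b c d m n" and ab: "a \<ge> 0" "b \<ge> 0"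
    by (rule exists_bracket_table[OF dim par nm])
  have g: "gram_diag e1 f1 e2 f2 1 1 1 1"
    using fr by (simp add: adapted_frame_def)
  note rel = jacobi_relations[OF g t]
  \<comment> \<open>Lagrange's identity turns each pair of Jacobi relations into the vanishing of a product.\<close>
  have "(a\<^sup>2 + m\<^sup>2) * (c\<^sup>2 + d\<^sup>2) = (a * c + m * d)\<^sup>2 + (a * d - m * c)\<^sup>2"
    by (simp add: power2_eq_square algebra_simps)
  then have 1: "a = 0 \<and> m = 0 \<or> c = 0 \<and> d = 0"
    using rel(1,2) by (simp only: mult_eq_0_iff sum_power2_eq_zero_iff power_zero_numeral
        add_0_left simp_thms)
  have "(b\<^sup>2 + c\<^sup>2) * (m\<^sup>2 + n\<^sup>2) = (b * m + c * n)\<^sup>2 + (b * n - c * m)\<^sup>2"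
    by (simp add: power2_eq_square algebra_simps)
  then have 2: "b = 0 \<and> c = 0 \<or> m = 0 \<and> n = 0"
    using rel(3,4) by (simp only: mult_eq_0_iff sum_power2_eq_zero_iff power_zero_numeral
        add_0_left simp_thms)
  consider "c = 0" "d = 0" "m = 0" "n = 0" | "c = 0" "d = 0" "m \<noteq> 0 \<or> n \<noteq> 0"
    | "c \<noteq> 0 \<or> d \<noteq> 0"
    by blast
  then show ?thesis
  proof cases
    case 1
    have "a \<noteq> 0 \<or> b \<noteq> 0"
      using abelian_if_zero_table[OF dim g] na t 1 by auto
    then show ?thesis
      using classified_affine[OF dim lin fr] t 1 ab by simp
  next
    case 2
    with \<open>b = 0 \<and> c = 0 \<or> m = 0 \<and> n = 0\<close> have "b = 0"
      by blast
    then show ?thesis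
      using classified_rotational[OF dim lin fr] t 2 ab rel by simp
  next
    case 3
    then have "a = 0" "m = 0" "n = 0"
      using 1 rel by auto
    then show ?thesis
      using classified_rotational[OF dim lin adapted_frame_swap[OF fr]]
        bracket_table_swap[OF t] 3 ab rel by simp
  qed
qed

section \<open>Parallel endomorphisms of the listed metric Lie algebras\<close>

text \<open>A family of brackets that contains all the listed ones; the two planes may have different
  scales \<open>t\<close> and \<open>u\<close>.\<close>

lemma block_rotation_parallel:
  assumes ob: "orthogonal_basis4 e1 f1 e2 f2" and g: "gram_diag e1 f1 e2 f2 t t u u"
    and br: "br e1 f1 = a *\<^sub>R f1" "br e2 f2 = b *\<^sub>R f2" "br e1 e2 = - m *\<^sub>R f2"
      "br e1 f2 = m *\<^sub>R e2" "br f1 e2 = 0" "br f1 f2 = 0"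
    and lin: "linear H" and bl: "block_rotation H e1 f1 e2 f2 a1 a2"
  shows "parallel_skew br H"
proof -
  have H: "H (x1 *\<^sub>R e1 + x2 *\<^sub>R f1 + x3 *\<^sub>R e2 + x4 *\<^sub>R f2) =
      (- (a1 * x2)) *\<^sub>R e1 + (a1 * x1) *\<^sub>R f1 + (- (a2 * x4)) *\<^sub>R e2 + (a2 * x3) *\<^sub>R f2"
    for x1 x2 x3 x4
    using bl by (simp add: block_rotation_def linear_add[OF lin] linear_scale[OF lin] mult.commute)
  have I: "(x1 *\<^sub>R e1 + x2 *\<^sub>R f1 + x3 *\<^sub>R e2 + x4 *\<^sub>R f2) \<bullet>
      (y1 *\<^sub>R e1 + y2 *\<^sub>R f1 + y3 *\<^sub>R e2 + y4 *\<^sub>R f2) =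
      t * (x1 * y1 + x2 * y2) + u * (x3 * y3 + x4 * y4)" for x1 x2 x3 x4 y1 y2 y3 y4
    by (simp add: inner_add_left inner_add_right gram_diag_inner[OF g] algebra_simps)
  have B: "br (x1 *\<^sub>R e1 + x2 *\<^sub>R f1 + x3 *\<^sub>R e2 + x4 *\<^sub>R f2)
        (y1 *\<^sub>R e1 + y2 *\<^sub>R f1 + y3 *\<^sub>R e2 + y4 *\<^sub>R f2) =
      0 *\<^sub>R e1 + (a * (x1 * y2 - x2 * y1)) *\<^sub>R f1 + (m * (x1 * y4 - x4 * y1)) *\<^sub>R e2 +
      (b * (x3 * y4 - x4 * y3) - m * (x1 * y3 - x3 * y1)) *\<^sub>R f2"
    for x1 x2 x3 x4 y1 y2 y3 y4
    by (simp add: br_lin alternating br antisym[of f1 e1] antisym[of f2 e2] antisym[of e2 e1]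
        antisym[of e2 f1] antisym[of f2 e1] antisym[of f2 f1] algebra_simps)
  have sk: "H x \<bullet> y = - (x \<bullet> H y)" for x y
  proof -
    obtain x1 x2 x3 x4 where x: "x = x1 *\<^sub>R e1 + x2 *\<^sub>R f1 + x3 *\<^sub>R e2 + x4 *\<^sub>R f2"
      by (rule orthogonal_basis4_expansion[OF ob])
    obtain y1 y2 y3 y4 where y: "y = y1 *\<^sub>R e1 + y2 *\<^sub>R f1 + y3 *\<^sub>R e2 + y4 *\<^sub>R f2"
      by (rule orthogonal_basis4_expansion[OF ob])
    show ?thesis
      unfolding x y H I by (simp add: algebra_simps)
  qed
  \<comment> \<open>For skew-symmetric \<open>H\<close>, the Koszul formula makes this trilinear expression twice the inner
    product of \<open>\<nabla>\<^sub>x (H y) - H (\<nabla>\<^sub>x y)\<close> with \<open>z\<close>.\<close>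
  have K: "(br x (H y) \<bullet> z - br (H y) z \<bullet> x + br z x \<bullet> H y) +
      (br x y \<bullet> H z - br y (H z) \<bullet> x + br (H z) x \<bullet> y) = 0" for x y z
  proof -
    obtain x1 x2 x3 x4 where x: "x = x1 *\<^sub>R e1 + x2 *\<^sub>R f1 + x3 *\<^sub>R e2 + x4 *\<^sub>R f2"
      by (rule orthogonal_basis4_expansion[OF ob])
    obtain y1 y2 y3 y4 where y: "y = y1 *\<^sub>R e1 + y2 *\<^sub>R f1 + y3 *\<^sub>R e2 + y4 *\<^sub>R f2"
      by (rule orthogonal_basis4_expansion[OF ob])
    obtain z1 z2 z3 z4 where z: "z = z1 *\<^sub>R e1 + z2 *\<^sub>R f1 + z3 *\<^sub>R e2 + z4 *\<^sub>R f2"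
      by (rule orthogonal_basis4_expansion[OF ob])
    show ?thesis
      unfolding x y z H B I by algebra
  qed
  have "nabla br x (H y) \<bullet> z = H (nabla br x y) \<bullet> z" for x y z
    using K[of x y z] koszul[OF bilinear_br, of x "H y" z] koszul[OF bilinear_br, of x y "H z"]
    by (simp add: sk)
  then have "nabla br x (H y) = H (nabla br x y)" for x y
    by (metis vector_eq_rdot)
  then show ?thesis
    using lin sk by (simp add: parallel_skew_def skew_symmetric_def)
qed

theorem listed_parallel:
  assumes ob: "orthogonal_basis4 e1 f1 e2 f2" and l: "listed_metric_lie_algebra br e1 f1 e2 f2"
    and lin: "linear H" and bl: "block_rotation H e1 f1 e2 f2 a1 a2"
  shows "parallel_skew br H"
proof -
  have "\<exists>t u a b m. gram_diag e1 f1 e2 f2 t t u u \<and> br e1 f1 = a *\<^sub>R f1 \<and> br e2 f2 = b *\<^sub>R f2 \<and>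
      br e1 e2 = - m *\<^sub>R f2 \<and> br e1 f2 = m *\<^sub>R e2 \<and> br f1 e2 = 0 \<and> br f1 f2 = 0"
    using l unfolding listed_metric_lie_algebra_def
  proof (elim disjE exE conjE)
    assume "metric_R_e2 br e1 f1 e2 f2"
    then obtain t where "gram_diag e1 f1 e2 f2 t t t t" and "br e1 f1 = 0" "br e2 f2 = 0"
      "br e1 e2 = - f2" "br e1 f2 = e2" "br f1 e2 = 0" "br f1 f2 = 0"
      unfolding metric_R_e2_def by blast
    then show ?thesis
      by (intro exI[of _ t] exI[of _ t] exI[of _ 0] exI[of _ 0] exI[of _ 1]) simp
  next
    assume "metric_R2_aff br e1 f1 e2 f2"
    then obtain t where "gram_diag e1 f1 e2 f2 t t t t" and "br e1 f1 = 0" "br e2 f2 = f2"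
      "br e1 e2 = 0" "br e1 f2 = 0" "br f1 e2 = 0" "br f1 f2 = 0"
      unfolding metric_R2_aff_def by blast
    then show ?thesis
      by (intro exI[of _ t] exI[of _ t] exI[of _ 0] exI[of _ 1] exI[of _ 0]) simp
  next
    fix l assume "metric_r4_prime br e1 f1 e2 f2 l"
    then obtain t where "gram_diag e1 f1 e2 f2 t t t t" and "br e1 f1 = l *\<^sub>R f1" "br e2 f2 = 0"
      "br e1 e2 = - f2" "br e1 f2 = e2" "br f1 e2 = 0" "br f1 f2 = 0"
      unfolding metric_r4_prime_def by blast
    then show ?thesis
      by (intro exI[of _ t] exI[of _ t] exI[of _ l] exI[of _ 0] exI[of _ 1]) simp
  next
    assume "metric_aff_aff br e1 f1 e2 f2"
    then obtain t s where "gram_diag e1 f1 e2 f2 t t (t * s) (t * s)"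
      and "br e1 f1 = f1" "br e2 f2 = f2"
      "br e1 e2 = 0" "br e1 f2 = 0" "br f1 e2 = 0" "br f1 f2 = 0"
      unfolding metric_aff_aff_def by blast
    then show ?thesis
      by (intro exI[of _ t] exI[of _ "t * s"] exI[of _ 1] exI[of _ 1] exI[of _ 0]) simp
  qed
  then show ?thesis
    using block_rotation_parallel[OF ob _ _ _ _ _ _ _ lin bl] by blast
qed

end

theorem theorem3p3:
  assumes "DIM('a::euclidean_space) = 4"
  shows
    "(\<forall>(br :: 'a \<Rightarrow> 'a \<Rightarrow> 'a) (H :: 'a \<Rightarrow> 'a).
        metric_lie_algebra br \<and> \<not> abelian br \<and> parallel_skew br H \<and>
        \<not> multiple_of_complex_structure H \<longrightarrow>
        (\<exists>e1 f1 e2 f2. orthogonal_basis4 e1 f1 e2 f2 \<and>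
           (\<exists>a1 a2. \<bar>a1\<bar> \<noteq> \<bar>a2\<bar> \<and> block_rotation H e1 f1 e2 f2 a1 a2) \<and>
           listed_metric_lie_algebra br e1 f1 e2 f2)) \<and>
     (\<forall>(br :: 'a \<Rightarrow> 'a \<Rightarrow> 'a) e1 f1 e2 f2.
        metric_lie_algebra br \<and> orthogonal_basis4 e1 f1 e2 f2 \<and>
        listed_metric_lie_algebra br e1 f1 e2 f2 \<longrightarrow>
        (\<forall>a1 a2. \<forall>H :: 'a \<Rightarrow> 'a.
           linear H \<and> block_rotation H e1 f1 e2 f2 a1 a2 \<longrightarrow> parallel_skew br H))"
proof (intro conjI allI impI; elim conjE)
  fix br :: "'a \<Rightarrow> 'a \<Rightarrow> 'a" and H :: "'a \<Rightarrow> 'a"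
  assume "metric_lie_algebra br" "\<not> abelian br" "parallel_skew br H"
    "\<not> multiple_of_complex_structure H"
  from metric_lie_algebra.classification[OF this(1) assms this(2-4)]
  show "\<exists>e1 f1 e2 f2. orthogonal_basis4 e1 f1 e2 f2 \<and>
      (\<exists>a1 a2. \<bar>a1\<bar> \<noteq> \<bar>a2\<bar> \<and> block_rotation H e1 f1 e2 f2 a1 a2) \<and>
      listed_metric_lie_algebra br e1 f1 e2 f2"
    by (simp only: classified_def)
next
  fix br :: "'a \<Rightarrow> 'a \<Rightarrow> 'a" and e1 f1 e2 f2 a1 a2 and H :: "'a \<Rightarrow> 'a"
  assume "metric_lie_algebra br" "orthogonal_basis4 e1 f1 e2 f2"
    "listed_metric_lie_algebra br e1 f1 e2 f2" "linear H" "block_rotation H e1 f1 e2 f2 a1 a2"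
  then show "parallel_skew br H"
    by (rule metric_lie_algebra.listed_parallel)
qed

end
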